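(* Suppose that the planar Hamiltonian system $\dot x=J_2DH(x)$ possesses a one-parameter family of periodic orbits $q^\alpha(t)$ with period $T^\alpha$, $\alpha\in(\alpha_1,\alpha_2)$, for some $\alpha_1<\alpha_2$, and that for a fixed $\alpha\in(\alpha_1,\alpha_2)$ the resonance condition $lT^\alpha=mT$ holds for relatively prime integers $l,m>0$. Let $\tau_0\in\mathbb{S}^1_T$. If the system $$\dot x=J_2DH(x)+\varepsilon g(x,\theta),\qquad \dot\theta=1,\qquad (x,\theta)\in\mathbb{R}^2\times\mathbb{S}^1_T,$$ has a $C^3$ first integral $F_\varepsilon(x,\theta)=H(x)+O(\varepsilon)$ depending $C^2$-smoothly on $\varepsilon$ in a neighborhood of $$\Gamma^\alpha_{\tau_0}=\{(q^\alpha(t-\tau_0),t)\mid t\in[0,mT)\},$$ then there exists a connected open set $\Pi\subset\mathbb{S}^1_T$ such that $\tau_0\in\Pi$ and the subharmonic Melnikov function $$M^{m/l}(\tau):=\int_0^{mT}DH(q^\alpha(t))\cdot g(q^\alpha(t),t+\tau)\,dt$$ is zero on $\Pi$.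
   Context: $\varepsilon$ is a small parameter, $0\le\varepsilon\ll1$. $T>0$ is a constant and $\mathbb{S}^1_T=\mathbb{R}/T\mathbb{Z}$; second components $t$ of points are read modulo $T$. $H:\mathbb{R}^2\to\mathbb{R}$ is $C^3$, $g:\mathbb{R}^2\times\mathbb{R}\to\mathbb{R}^2$ is $C^2$ and $g(x,t)$ is $T$-periodic in $t$, $J_2=\begin{pmatrix}0&1\\-1&0\end{pmatrix}$, and "$\cdot$" is the standard inner product in $\mathbb{R}^2$. *)

theory Defs
  imports "HOL-Analysis.Analysis" "HOL-Library.Landau_Symbols"
begin

text \<open>
  Class \<open>C\<^sup>k\<close> on an open subset of a Euclidean space: on an open set in finite dimension,
  continuity of all iterated directional derivatives is continuity of the iterated total derivative.
\<close>

fun Ck_on :: "nat \<Rightarrow> 'a::euclidean_space set \<Rightarrow> ('a \<Rightarrow> 'b::real_normed_vector) \<Rightarrow> bool" where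
  "Ck_on 0 S f \<longleftrightarrow> continuous_on S f"
| "Ck_on (Suc k) S f \<longleftrightarrow>
     (\<forall>x\<in>S. f differentiable (at x)) \<and> (\<forall>v. Ck_on k S (\<lambda>x. frechet_derivative f (at x) v))"

text \<open>
  \<open>C\<^sup>k\<close> dependence of a family \<open>F \<epsilon>\<close> of functions on \<open>U\<close> on the real parameter \<open>\<epsilon> \<in> E\<close>: the
  \<open>\<epsilon>\<close>-derivatives \<open>D j\<close> of order \<open>j \<le> k\<close> exist (one-sided at end points of \<open>E\<close> that belong to \<open>E\<close>)
  and are continuous in \<open>\<epsilon>\<close> and the point jointly. No mixed derivatives are required.
\<close>

definition Ck_dependence ::
  "nat \<Rightarrow> real set \<Rightarrow> 'a::topological_space set \<Rightarrow> (real \<Rightarrow> 'a \<Rightarrow> real) \<Rightarrow> bool" where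
  "Ck_dependence k E U F \<longleftrightarrow>
     (\<exists>D. D 0 = F \<and>
        (\<forall>j<k. \<forall>\<epsilon>\<in>E. \<forall>p\<in>U. ((\<lambda>e. D j e p) has_real_derivative D (Suc j) \<epsilon> p) (at \<epsilon> within E)) \<and>
        (\<forall>j\<le>k. continuous_on (E \<times> U) (\<lambda>(\<epsilon>, p). D j \<epsilon> p)))"

definition J2 :: "real^2^2" where
  "J2 = vector [vector [0, 1], vector [-1, 0]]"

definition grad :: "(real^2 \<Rightarrow> real) \<Rightarrow> real^2 \<Rightarrow> real^2" where
  "grad H x = (\<chi> i. frechet_derivative H (at x) (axis i 1))"

definition periodic_orbit :: "(real^2 \<Rightarrow> real^2) \<Rightarrow> real \<Rightarrow> (real \<Rightarrow> real^2) \<Rightarrow> bool" where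
  "periodic_orbit X P q \<longleftrightarrow>
     (\<forall>t. (q has_vector_derivative X (q t)) (at t)) \<and>
     P > 0 \<and> (\<forall>t. q (t + P) = q t) \<and> \<not> q constant_on UNIV"

text \<open>
  The circle \<open>\<real>/T\<int>\<close> is realised as the unit circle in the complex plane, the class of \<open>t\<close> modulo
  \<open>T\<close> being the point \<open>circ T t\<close>. Its topology is the subspace topology, and the phase space
  \<open>\<real>\<^sup>2 \<times> \<real>/T\<int>\<close> is \<open>UNIV \<times> S1\<close>. Differential notions on the phase space are read in the coordinate
  \<open>t\<close>, that is, after pulling sets and functions back along the covering map \<open>(x, t) \<mapsto> (x, circ T t)\<close>.
\<close>

definition S1 :: "complex set" where
  "S1 = sphere 0 1"

definition circ :: "real \<Rightarrow> real \<Rightarrow> complex" where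
  "circ T t = cis (2 * pi * t / T)"

definition lift_set :: "real \<Rightarrow> ((real^2) \<times> complex) set \<Rightarrow> ((real^2) \<times> real) set" where
  "lift_set T U = {(x, t). (x, circ T t) \<in> U}"

definition lift_fun :: "real \<Rightarrow> ((real^2) \<times> complex \<Rightarrow> real) \<Rightarrow> ((real^2) \<times> real \<Rightarrow> real)" where
  "lift_fun T f = (\<lambda>(x, t). f (x, circ T t))"

definition perturbed_field ::
  "(real^2 \<Rightarrow> real) \<Rightarrow> (real^2 \<Rightarrow> real \<Rightarrow> real^2) \<Rightarrow> real \<Rightarrow> (real^2) \<times> real \<Rightarrow> (real^2) \<times> real" where
  "perturbed_field H g \<epsilon> = (\<lambda>(x, \<theta>). (J2 *v grad H x + \<epsilon> *\<^sub>R g x \<theta>, 1))"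

definition first_integral_on ::
  "'a::real_normed_vector set \<Rightarrow> ('a \<Rightarrow> 'a) \<Rightarrow> ('a \<Rightarrow> real) \<Rightarrow> bool" where
  "first_integral_on W X f \<longleftrightarrow>
     (\<forall>p\<in>W. f differentiable (at p) \<and> frechet_derivative f (at p) (X p) = 0)"

definition resonant_orbit :: "real \<Rightarrow> nat \<Rightarrow> (real \<Rightarrow> real^2) \<Rightarrow> real \<Rightarrow> ((real^2) \<times> complex) set" where
  "resonant_orbit T m q \<tau>0 = {(q (t - \<tau>0), circ T t) | t. t \<in> {0..<real m * T}}"

definition Melnikov ::
  "(real^2 \<Rightarrow> real) \<Rightarrow> (real^2 \<Rightarrow> real \<Rightarrow> real^2) \<Rightarrow> real \<Rightarrow> nat \<Rightarrow> (real \<Rightarrow> real^2) \<Rightarrow> real \<Rightarrow> real" where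
  "Melnikov H g T m q \<tau> = integral {0..real m * T} (\<lambda>t. grad H (q t) \<bullet> g (q t) (t + \<tau>))"

end

theory Submission
  imports Defs
begin

text \<open>
  Follow, for small \<open>\<epsilon> > 0\<close>, the solution \<open>y\<^sub>\<epsilon>\<close> of the perturbed system that starts on the resonant
  orbit \<open>z\<close>, over the whole resonance time \<open>L = m T\<close>. It stays within \<open>O(\<epsilon>)\<close> of \<open>z\<close>. Two expressions
  for the energy gained by \<open>y\<^sub>\<epsilon>\<close> are compared. Since \<open>DH \<cdot> J\<^sub>2 DH = 0\<close>, integration of
  \<open>d/dt H(y\<^sub>\<epsilon>) = \<epsilon> DH(y\<^sub>\<epsilon>) \<cdot> g(y\<^sub>\<epsilon>, t)\<close> gives \<open>\<epsilon> (M + o(1))\<close>, where \<open>M\<close> is the Melnikov integral.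
  On the other hand \<open>F\<^sub>\<epsilon>\<close> is constant along \<open>y\<^sub>\<epsilon>\<close> and \<open>F\<^sub>\<epsilon> = H + \<epsilon> R\<^sub>\<epsilon>\<close>, so the gain is also
  \<open>\<epsilon> (R\<^sub>\<epsilon>(start) - R\<^sub>\<epsilon>(end))\<close>. In the phase space over the circle, \<open>z\<close> closes up after time \<open>L\<close>, so
  the start and the end point of \<open>y\<^sub>\<epsilon>\<close> converge to the same point, and joint continuity of the
  \<open>\<epsilon>\<close>-derivative of \<open>F\<close> makes both values of \<open>R\<^sub>\<epsilon>\<close> converge to the same limit. Hence \<open>M = 0\<close>.

  Exact solutions of the perturbed system are the right curves to follow: each \<open>F\<^sub>\<epsilon>\<close> is differentiable
  in the point, but convergence of its differential to \<open>DH\<close> as \<open>\<epsilon> \<rightarrow> 0\<close> is not part of the assumed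
  smoothness in \<open>\<epsilon>\<close>, so differentiating \<open>F\<^sub>\<epsilon>\<close> along \<open>z\<close> itself would leave \<open>DF\<^sub>\<epsilon> \<cdot> g\<close> in place of
  \<open>DH \<cdot> g\<close> under the integral. The solutions come from Picard iteration started at \<open>z\<close>
  (\<open>picard_near_approximate_solution\<close>, \<open>perturbed_solutions\<close>); the comparison of the two
  expansions is \<open>first_order_expansion_imp_integral_zero\<close>.

  The argument applies to every phase \<open>\<tau>\<close> for which the shifted orbit stays in \<open>U\<close>. By compactness of the
  orbit these phases form an open subset of the circle, and \<open>P\<close> is a connected open neighbourhood
  of the class of \<open>\<tau>0\<close> inside it.
\<close>

section \<open>Solutions near an approximate solution\<close>

text \<open>
  If \<open>z\<close> satisfies the integral equation up to an error \<open>c\<close>, the Picard iterates started at \<open>z\<close> move by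
  at most \<open>c (K t)\<^sup>n / n!\<close> in step \<open>n\<close>. The moves add up to at most \<open>c exp (K L)\<close>, so the iterates never
  leave the tube of radius \<open>r\<close> on which the Lipschitz bound holds, and they converge uniformly. Starting
  at \<open>z\<close> yields existence on all of \<open>[0, L]\<close> together with the distance estimate.
\<close>

lemma picard_near_approximate_solution:
  fixes G :: "'a::banach \<Rightarrow> real \<Rightarrow> 'a" and z :: "real \<Rightarrow> 'a"
  assumes L: "0 \<le> L" and K: "0 \<le> K" and contz: "continuous_on {0..L} z"
    and contG: "continuous_on {(x, t). t \<in> {0..L} \<and> norm (x - z t) \<le> r} (\<lambda>(x, t). G x t)"
    and lip: "\<And>t x x'. \<lbrakk>t \<in> {0..L}; norm (x - z t) \<le> r; norm (x' - z t) \<le> r\<rbrakk>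
                \<Longrightarrow> norm (G x t - G x' t) \<le> K * norm (x - x')"
    and defect: "\<And>t. t \<in> {0..L} \<Longrightarrow> norm (z 0 + integral {0..t} (\<lambda>s. G (z s) s) - z t) \<le> c"
    and small: "c * exp (K * L) \<le> r"
  obtains y where "y 0 = z 0"
    and "\<And>t. t \<in> {0..L} \<Longrightarrow> (y has_vector_derivative G (y t) t) (at t within {0..L})"
    and "\<And>t. t \<in> {0..L} \<Longrightarrow> norm (y t - z t) \<le> c * exp (K * L)"
proof -
  have exp_sums: "(\<lambda>k. x ^ k / fact k) sums exp x" for x :: real
    using exp_converges[of x] by (simp add: divide_inverse mult.commute)
  define P where "P = (\<lambda>u t. z 0 + integral {0..t} (\<lambda>s. G (u s) s))"
  define y where "y = (\<lambda>n. (P ^^ n) z)"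
  have y0: "y 0 = z" and ySuc: "\<And>n. y (Suc n) = P (y n)"
    by (simp_all add: y_def)
  have c0: "0 \<le> c"
    using defect[of 0] L norm_ge_zero order_trans by (metis atLeastAtMost_iff order_refl)
  have contGu: "continuous_on {0..L} (\<lambda>t. G (u t) t)"
    if "continuous_on {0..L} u" "\<And>t. t \<in> {0..L} \<Longrightarrow> norm (u t - z t) \<le> r" for u
  proof -
    have "continuous_on {0..L} (\<lambda>t. (\<lambda>(x, t). G x t) (u t, t))"
      by (rule continuous_on_compose2[OF contG]) (use that in \<open>auto intro!: continuous_intros\<close>)
    then show ?thesis by simp
  qed
  have contP: "continuous_on {0..L} (P u)"
    if "continuous_on {0..L} u" "\<And>t. t \<in> {0..L} \<Longrightarrow> norm (u t - z t) \<le> r" for u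
    unfolding P_def
    by (intro continuous_intros indefinite_integral_continuous_1 integrable_continuous_interval
          contGu that)
  have Pdiff: "norm (P u t - P v t) \<le> integral {0..t} b"
    if u: "continuous_on {0..L} u" "\<And>t. t \<in> {0..L} \<Longrightarrow> norm (u t - z t) \<le> r"
      and v: "continuous_on {0..L} v" "\<And>t. t \<in> {0..L} \<Longrightarrow> norm (v t - z t) \<le> r"
      and b: "continuous_on {0..L} b" "\<And>t. t \<in> {0..L} \<Longrightarrow> K * norm (u t - v t) \<le> b t"
      and t: "t \<in> {0..L}" for u v b t
  proof -
    have sub: "{0..t} \<subseteq> {0..L}" using t by auto
    have iu: "(\<lambda>s. G (u s) s) integrable_on {0..t}" and iv: "(\<lambda>s. G (v s) s) integrable_on {0..t}"
      using contGu[OF u] contGu[OF v] continuous_on_subset[OF _ sub]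
      by (blast intro: integrable_continuous_interval)+
    have "P u t - P v t = integral {0..t} (\<lambda>s. G (u s) s - G (v s) s)"
      unfolding P_def using integral_diff[OF iu iv] by simp
    also have "norm \<dots> \<le> integral {0..t} b"
    proof (rule integral_norm_bound_integral)
      show "(\<lambda>s. G (u s) s - G (v s) s) integrable_on {0..t}"
        using iu iv by (rule integrable_diff)
      show "b integrable_on {0..t}"
        using b(1) continuous_on_subset[OF _ sub] by (blast intro: integrable_continuous_interval)
      show "norm (G (u s) s - G (v s) s) \<le> b s" if "s \<in> {0..t}" for s
        using lip[of s "u s" "v s"] u(2)[of s] v(2)[of s] b(2)[of s] that sub by force
    qed
    finally show ?thesis .
  qed
  have exp_bound: "c * (\<Sum>k<n. (K * t) ^ k / fact k) \<le> c * exp (K * L)" if t: "t \<in> {0..L}" for n t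
  proof (rule mult_left_mono[OF _ c0])
    have "(\<Sum>k<n. (K * t) ^ k / fact k) \<le> (\<Sum>k. (K * t) ^ k / fact k)"
      using exp_sums[of "K * t"] K t by (intro sum_le_suminf) (auto simp: sums_iff)
    also have "\<dots> = exp (K * t)"
      using exp_sums[of "K * t"] by (simp add: sums_iff)
    also have "\<dots> \<le> exp (K * L)"
      using t K by (simp add: mult_left_mono)
    finally show "(\<Sum>k<n. (K * t) ^ k / fact k) \<le> exp (K * L)" .
  qed
  have iter: "continuous_on {0..L} (y n) \<and>
      (\<forall>t\<in>{0..L}. norm (y n t - z t) \<le> c * (\<Sum>k<n. (K * t) ^ k / fact k)) \<and>
      (\<forall>t\<in>{0..L}. norm (y (Suc n) t - y n t) \<le> c * ((K * t) ^ n / fact n))" for n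
  proof (induction n)
    case 0
    then show ?case
      using contz defect by (simp add: y0 ySuc P_def)
  next
    case (Suc n)
    have cn: "continuous_on {0..L} (y n)"
      and close: "\<And>t. t \<in> {0..L} \<Longrightarrow> norm (y n t - z t) \<le> c * (\<Sum>k<n. (K * t) ^ k / fact k)"
      and step: "\<And>t. t \<in> {0..L} \<Longrightarrow> norm (y (Suc n) t - y n t) \<le> c * ((K * t) ^ n / fact n)"
      using Suc.IH by auto
    have rn: "norm (y n t - z t) \<le> r" if "t \<in> {0..L}" for t
      using close[OF that] exp_bound[OF that, of n] small by linarith
    have cS: "continuous_on {0..L} (y (Suc n))"
      unfolding ySuc using contP[OF cn rn] .
    have closeS: "norm (y (Suc n) t - z t) \<le> c * (\<Sum>k<Suc n. (K * t) ^ k / fact k)"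
      if "t \<in> {0..L}" for t
    proof -
      have "norm (y (Suc n) t - z t) \<le> norm (y (Suc n) t - y n t) + norm (y n t - z t)"
        using norm_triangle_ineq[of "y (Suc n) t - y n t" "y n t - z t"] by simp
      then show ?thesis
        using close[OF that] step[OF that] by (simp add: distrib_left)
    qed
    have rS: "norm (y (Suc n) t - z t) \<le> r" if "t \<in> {0..L}" for t
      using closeS[OF that] exp_bound[OF that, of "Suc n"] small by linarith
    have stepS: "norm (y (Suc (Suc n)) t - y (Suc n) t) \<le> c * ((K * t) ^ Suc n / fact (Suc n))"
      if t: "t \<in> {0..L}" for t
    proof -
      have "((\<lambda>s. K * (c * ((K * s) ^ n / fact n))) has_integral
          c * ((K * t) ^ Suc n / fact (Suc n)) - c * ((K * 0) ^ Suc n / fact (Suc n))) {0..t}"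
      proof (rule fundamental_theorem_of_calculus)
        show "0 \<le> t" using t by simp
        fix s assume "s \<in> {0..t}"
        have "((\<lambda>s. c * ((K * s) ^ Suc n / fact (Suc n))) has_real_derivative
            K * (c * ((K * s) ^ n / fact n))) (at s within {0..t})"
          by (rule derivative_eq_intros refl | simp)+
        then show "((\<lambda>s. c * ((K * s) ^ Suc n / fact (Suc n))) has_vector_derivative
            K * (c * ((K * s) ^ n / fact n))) (at s within {0..t})"
          by (simp add: has_real_derivative_iff_has_vector_derivative)
      qed
      from integral_unique[OF this] have int: "integral {0..t} (\<lambda>s. K * (c * ((K * s) ^ n / fact n)))
          = c * ((K * t) ^ Suc n / fact (Suc n))"
        by simp
      have "norm (P (y (Suc n)) t - P (y n) t)
          \<le> integral {0..t} (\<lambda>s. K * (c * ((K * s) ^ n / fact n)))"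
        by (intro Pdiff cS rS cn rn t mult_left_mono step K) (auto intro!: continuous_intros)
      also note int
      finally show ?thesis by (simp add: ySuc)
    qed
    show ?case using cS closeS stepS by blast
  qed
  have close: "norm (y n t - z t) \<le> c * exp (K * L)" if "t \<in> {0..L}" for n t
    using iter[of n] exp_bound[OF that, of n] that by force
  define Y where "Y = (\<lambda>t. z t + (\<Sum>k. y (Suc k) t - y k t))"
  have lim: "uniform_limit {0..L} y Y sequentially"
  proof -
    have "uniform_limit {0..L} (\<lambda>n t. \<Sum>k<n. y (Suc k) t - y k t)
        (\<lambda>t. \<Sum>k. y (Suc k) t - y k t) sequentially"
    proof (rule Weierstrass_m_test)
      show "norm (y (Suc n) t - y n t) \<le> c * ((K * L) ^ n / fact n)" if t: "t \<in> {0..L}" for n t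
      proof -
        have "norm (y (Suc n) t - y n t) \<le> c * ((K * t) ^ n / fact n)"
          using iter[of n] t by blast
        also have "\<dots> \<le> c * ((K * L) ^ n / fact n)"
          using t K by (intro mult_left_mono c0 divide_right_mono power_mono) auto
        finally show ?thesis .
      qed
      show "summable (\<lambda>n. c * ((K * L) ^ n / fact n))"
        using exp_sums[of "K * L"] by (intro summable_mult) (simp add: sums_iff)
    qed
    then have "uniform_limit {0..L} (\<lambda>n t. z t + (\<Sum>k<n. y (Suc k) t - y k t)) Y sequentially"
      unfolding Y_def by (intro uniform_limit_intros)
    moreover have "z t + (\<Sum>k<n. y (Suc k) t - y k t) = y n t" for n t
      using sum_lessThan_telescope[of "\<lambda>k. y k t" n] by (simp add: y0)
    ultimately show ?thesis by simp
  qed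
  have pointwise: "(\<lambda>n. y n t) \<longlonglongrightarrow> Y t" if "t \<in> {0..L}" for t
    using tendsto_uniform_limitI[OF lim that] .
  have contY: "continuous_on {0..L} Y"
    by (rule uniform_limit_theorem[OF _ lim]) (use iter in auto)
  have closeY: "norm (Y t - z t) \<le> c * exp (K * L)" if "t \<in> {0..L}" for t
    by (rule tendsto_upperbound[OF tendsto_norm[OF tendsto_diff[OF pointwise[OF that] tendsto_const]]])
      (use close that in auto)
  have fixp: "Y t = P Y t" if t: "t \<in> {0..L}" for t
  proof (rule LIMSEQ_unique)
    show "(\<lambda>n. y (Suc n) t) \<longlonglongrightarrow> Y t"
      using pointwise[OF t] by (rule LIMSEQ_Suc)
    show "(\<lambda>n. y (Suc n) t) \<longlonglongrightarrow> P Y t"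
    proof (rule tendstoI)
      fix e :: real assume e: "e > 0"
      define A where "A = K * L + 1"
      define d where "d = e / (2 * A)"
      have A: "A > 0" using K L by (simp add: A_def add_nonneg_pos)
      then have d: "d > 0" using e by (simp add: d_def)
      have "\<forall>\<^sub>F n in sequentially. \<forall>t\<in>{0..L}. dist (y n t) (Y t) < d"
        using uniform_limitD[OF lim d] .
      then show "\<forall>\<^sub>F n in sequentially. dist (y (Suc n) t) (P Y t) < e"
      proof eventually_elim
        case (elim n)
        have "norm (P (y n) t - P Y t) \<le> integral {0..t} (\<lambda>s. K * d)"
        proof (rule Pdiff)
          show "continuous_on {0..L} (y n)" using iter by blast
          show "norm (y n s - z s) \<le> r" if "s \<in> {0..L}" for s
            using close[OF that, of n] small by linarith
          show "continuous_on {0..L} Y" by (rule contY)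
          show "norm (Y s - z s) \<le> r" if "s \<in> {0..L}" for s
            using closeY[OF that] small by linarith
          show "K * norm (y n s - Y s) \<le> K * d" if "s \<in> {0..L}" for s
            using elim that K by (intro mult_left_mono) (auto simp: dist_norm less_imp_le)
        qed (use t in auto)
        also have "\<dots> = (K * t) * d" using t by simp
        also have "\<dots> \<le> A * d"
          using t d mult_left_mono[of t L K] K by (intro mult_right_mono) (auto simp: A_def)
        also have "\<dots> = e / 2" using A by (simp add: d_def)
        also have "\<dots> < e" using e by simp
        finally show ?case by (simp add: dist_norm ySuc)
      qed
    qed
  qed
  have derivY: "(Y has_vector_derivative G (Y t) t) (at t within {0..L})" if t: "t \<in> {0..L}" for t
  proof -
    have "continuous_on {0..L} (\<lambda>t. G (Y t) t)"
      by (rule contGu[OF contY]) (use closeY small in force)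
    then have "(P Y has_vector_derivative G (Y t) t) (at t within {0..L})"
      unfolding P_def using t
      by (auto intro!: derivative_eq_intros integral_has_vector_derivative)
    then show ?thesis
      by (rule has_vector_derivative_transform[rotated 2]) (use t fixp in auto)
  qed
  have "Y 0 = z 0" using fixp[of 0] L by (simp add: P_def)
  with derivY closeY show thesis by (intro that)
qed

section \<open>Lipschitz bounds for continuously differentiable maps\<close>

lemma Ck_on_Suc_imp: "Ck_on (Suc k) S f \<Longrightarrow> Ck_on k S f"
proof (induction k arbitrary: f)
  case 0
  then show ?case
    by (simp add: continuous_at_imp_continuous_on differentiable_imp_continuous_within)
next
  case (Suc k)
  then have "\<forall>v. Ck_on (Suc k) S (\<lambda>x. frechet_derivative f (at x) v)"
    by (subst (asm) Ck_on.simps) blast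
  with Suc show ?case
    by (subst Ck_on.simps) auto
qed

lemma Ck_on_Suc_0D:
  assumes "Ck_on (Suc k) S f"
  shows "Ck_on (Suc 0) S f"
  using assms by (induction k) (blast intro: Ck_on_Suc_imp)+

text \<open>
  The norm of the derivative is at most the sum of the norms of the partial derivatives, which are
  continuous and hence bounded on a compact set; convexity turns this into a Lipschitz bound.
\<close>

lemma C1_imp_lipschitz_on:
  fixes f :: "'a::euclidean_space \<Rightarrow> 'b::real_normed_vector"
  assumes f: "Ck_on (Suc k) S f" and C: "compact C" "convex C" "C \<subseteq> S"
  shows "\<exists>B. B-lipschitz_on C f"
proof -
  have diff: "\<And>x. x \<in> S \<Longrightarrow> f differentiable (at x)"
    and cont: "\<And>v. continuous_on S (\<lambda>x. frechet_derivative f (at x) v)"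
    using Ck_on_Suc_0D[OF f] by auto
  have "\<exists>M. \<forall>x\<in>C. norm (frechet_derivative f (at x) b) \<le> M" for b
    by (rule continuous_on_compact_bound[OF C(1) continuous_on_subset[OF cont[of b] C(3)]]) blast
  then obtain M where M: "\<And>b x. x \<in> C \<Longrightarrow> norm (frechet_derivative f (at x) b) \<le> M b"
    by metis
  define B where "B = (\<Sum>b\<in>Basis. \<bar>M b\<bar>)"
  have "norm (f x - f y) \<le> B * norm (x - y)" if "x \<in> C" "y \<in> C" for x y
  proof (rule differentiable_bound[OF \<open>convex C\<close> _ _ that])
    fix x assume x: "x \<in> C"
    then have D: "(f has_derivative frechet_derivative f (at x)) (at x)"
      using diff C frechet_derivative_works by blast
    then show "(f has_derivative frechet_derivative f (at x)) (at x within C)"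
      by (rule has_derivative_at_withinI)
    interpret D: bounded_linear "frechet_derivative f (at x)"
      using D by (rule has_derivative_bounded_linear)
    show "onorm (frechet_derivative f (at x)) \<le> B"
    proof (rule onorm_le)
      fix h
      have "frechet_derivative f (at x) h
          = frechet_derivative f (at x) (\<Sum>b\<in>Basis. (h \<bullet> b) *\<^sub>R b)"
        by (simp add: euclidean_representation)
      also have "\<dots> = (\<Sum>b\<in>Basis. (h \<bullet> b) *\<^sub>R frechet_derivative f (at x) b)"
        by (simp add: D.sum D.scaleR)
      also have "norm \<dots> \<le> (\<Sum>b\<in>Basis. norm h * \<bar>M b\<bar>)"
      proof (rule sum_norm_le)
        fix b :: 'a assume b: "b \<in> Basis"
        have "norm (frechet_derivative f (at x) b) \<le> \<bar>M b\<bar>"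
          using M[OF x, of b] by linarith
        then show "norm ((h \<bullet> b) *\<^sub>R frechet_derivative f (at x) b) \<le> norm h * \<bar>M b\<bar>"
          using Basis_le_norm[OF b, of h] by (simp add: mult_mono)
      qed
      finally show "norm (frechet_derivative f (at x) h) \<le> B * norm h"
        by (simp add: B_def sum_distrib_left mult.commute)
    qed
  qed
  then have "B-lipschitz_on C f"
    by (intro lipschitz_onI) (auto simp: dist_norm B_def intro: sum_nonneg)
  then show ?thesis ..
qed

section \<open>First integrals of a perturbed system\<close>

text \<open>
  A solution \<open>z\<close> of the unperturbed equation solves the perturbed one up to the error
  \<open>\<epsilon> \<integral> g(z(s), s) ds = O(\<epsilon>)\<close>. Picard iteration therefore produces solutions of the perturbed equation at
  distance \<open>O(\<epsilon>)\<close> from \<open>z\<close>, with one constant \<open>C\<close> for all small \<open>\<epsilon>\<close>.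
\<close>

lemma perturbed_solutions:
  fixes X :: "'a::euclidean_space \<Rightarrow> 'a" and g :: "'a \<Rightarrow> real \<Rightarrow> 'a" and z :: "real \<Rightarrow> 'a"
  assumes L: "0 \<le> L"
    and lipX: "\<And>C. \<lbrakk>compact C; convex C\<rbrakk> \<Longrightarrow> \<exists>B. B-lipschitz_on C X"
    and lipg: "\<And>C. \<lbrakk>compact C; convex C\<rbrakk> \<Longrightarrow> \<exists>B. B-lipschitz_on C (\<lambda>(x, t). g x t)"
    and z: "\<And>t. t \<in> {0..L} \<Longrightarrow> (z has_vector_derivative X (z t)) (at t within {0..L})"
    and r: "0 < r"
  obtains C e where "0 \<le> C" and "0 < e" and "e * C \<le> r"
    and "\<And>\<epsilon>. \<epsilon> \<in> {0..e} \<Longrightarrow> \<exists>y. y 0 = z 0 \<and>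
      (\<forall>t\<in>{0..L}. (y has_vector_derivative X (y t) + \<epsilon> *\<^sub>R g (y t) t) (at t within {0..L}) \<and>
        norm (y t - z t) \<le> \<epsilon> * C)"
proof -
  have contz: "continuous_on {0..L} z"
    by (rule continuous_on_vector_derivative[OF z])
  obtain R where R: "\<And>t. t \<in> {0..L} \<Longrightarrow> norm (z t) \<le> R"
    using continuous_on_compact_bound[OF compact_Icc contz] by blast
  define C where "C = cball (0::'a) (R + r)"
  define D where "D = C \<times> {0..L}"
  have CD: "compact C" "convex C" "compact D" "convex D"
    by (auto simp: C_def D_def compact_Times convex_Times)
  obtain BX Bg where BX: "BX-lipschitz_on C X" and Bg: "Bg-lipschitz_on D (\<lambda>(x, t). g x t)"
    using lipX[OF CD(1,2)] lipg[OF CD(3,4)] by blast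
  have tube: "x \<in> C" "(x, t) \<in> D" if "t \<in> {0..L}" "norm (x - z t) \<le> r" for x t
    using that R[of t] norm_triangle_ineq[of "x - z t" "z t"] by (auto simp: C_def D_def)
  have contX: "continuous_on C X" and contg: "continuous_on D (\<lambda>(x, t). g x t)"
    using BX Bg by (blast intro: lipschitz_on_continuous_on)+
  define K where "K = BX + Bg"
  have B0: "0 \<le> BX" "0 \<le> Bg"
    using BX Bg by (blast intro: lipschitz_on_nonneg)+
  have contzX: "continuous_on {0..L} (\<lambda>t. X (z t))"
    by (rule continuous_on_compose2[OF contX contz]) (use tube r in auto)
  have contzg: "continuous_on {0..L} (\<lambda>t. g (z t) t)"
  proof -
    have "continuous_on {0..L} (\<lambda>t. (\<lambda>(x, t). g x t) (z t, t))"
      by (rule continuous_on_compose2[OF contg])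
        (use tube r contz in \<open>auto intro: continuous_on_Pair\<close>)
    then show ?thesis by simp
  qed
  obtain M where M0: "0 \<le> M" and M: "\<And>t. t \<in> {0..L} \<Longrightarrow> norm (g (z t) t) \<le> M"
    using continuous_on_compact_bound[OF compact_Icc contzg] by blast
  define c where "c = M * L * exp (K * L)"
  define e where "e = min 1 (r / (c + 1))"
  have c0: "0 \<le> c" using M0 L by (simp add: c_def)
  have e: "0 < e" "e \<le> 1" "e * c \<le> r"
  proof -
    show "0 < e" "e \<le> 1" using r c0 by (auto simp: e_def)
    have "e * c \<le> (r / (c + 1)) * (c + 1)"
      using c0 r by (intro mult_mono) (auto simp: e_def)
    then show "e * c \<le> r" using c0 by simp
  qed
  have "\<exists>y. y 0 = z 0 \<and>
      (\<forall>t\<in>{0..L}. (y has_vector_derivative X (y t) + \<epsilon> *\<^sub>R g (y t) t) (at t within {0..L}) \<and>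
        norm (y t - z t) \<le> \<epsilon> * c)" if eps: "\<epsilon> \<in> {0..e}" for \<epsilon>
  proof -
    have eps01: "0 \<le> \<epsilon>" "\<epsilon> \<le> 1" using eps e by auto
    show ?thesis
    proof (rule picard_near_approximate_solution[of L K z r "\<lambda>x t. X x + \<epsilon> *\<^sub>R g x t" "\<epsilon> * M * L"])
      show "0 \<le> L" "0 \<le> K" "continuous_on {0..L} z"
        using L B0 contz by (auto simp: K_def)
      let ?T = "{(x, t). t \<in> {0..L} \<and> norm (x - z t) \<le> r}"
      have "continuous_on ?T (\<lambda>p. X (fst p))"
        by (rule continuous_on_compose2[OF contX]) (use tube in \<open>auto intro!: continuous_intros\<close>)
      moreover have "continuous_on ?T (\<lambda>(x, t). g x t)"
        by (rule continuous_on_subset[OF contg]) (use tube in auto)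
      ultimately show "continuous_on ?T (\<lambda>(x, t). X x + \<epsilon> *\<^sub>R g x t)"
        by (auto simp: case_prod_unfold intro!: continuous_intros)
    next
      fix t x x' assume h: "t \<in> {0..L}" "norm (x - z t) \<le> r" "norm (x' - z t) \<le> r"
      have "norm (X x - X x') \<le> BX * norm (x - x')"
        using lipschitz_onD[OF BX] tube(1)[of t] h by (simp add: dist_norm)
      moreover have "norm (g x t - g x' t) \<le> Bg * norm (x - x')"
        using lipschitz_onD[OF Bg, of "(x, t)" "(x', t)"] tube(2)[of t] h by (simp add: dist_norm)
      then have "\<epsilon> * norm (g x t - g x' t) \<le> 1 * (Bg * norm (x - x'))"
        using eps01 by (intro mult_mono) auto
      moreover have "norm ((X x - X x') + \<epsilon> *\<^sub>R (g x t - g x' t))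
          \<le> norm (X x - X x') + \<epsilon> * norm (g x t - g x' t)"
        using norm_triangle_ineq[of "X x - X x'" "\<epsilon> *\<^sub>R (g x t - g x' t)"] eps01 by simp
      ultimately show "norm (X x + \<epsilon> *\<^sub>R g x t - (X x' + \<epsilon> *\<^sub>R g x' t)) \<le> K * norm (x - x')"
        by (simp add: K_def algebra_simps)
    next
      fix t assume t: "t \<in> {0..L}"
      then have sub: "{0..t} \<subseteq> {0..L}" by auto
      have iX: "((\<lambda>s. X (z s)) has_integral z t - z 0) {0..t}"
        using t sub
        by (intro fundamental_theorem_of_calculus has_vector_derivative_within_subset[OF z sub]) auto
      have ig: "(\<lambda>s. g (z s) s) integrable_on {0..t}"
        using contzg continuous_on_subset[OF _ sub] by (blast intro: integrable_continuous_interval)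
      have "((\<lambda>s. X (z s) + \<epsilon> *\<^sub>R g (z s) s) has_integral
          (z t - z 0) + \<epsilon> *\<^sub>R integral {0..t} (\<lambda>s. g (z s) s)) {0..t}"
        by (intro has_integral_add iX has_integral_cmul integrable_integral ig)
      then have "norm (z 0 + integral {0..t} (\<lambda>s. X (z s) + \<epsilon> *\<^sub>R g (z s) s) - z t)
          = \<epsilon> * norm (integral {0..t} (\<lambda>s. g (z s) s))"
        using eps01 by (simp add: integral_unique)
      also have "norm (integral {0..t} (\<lambda>s. g (z s) s)) \<le> integral {0..t} (\<lambda>s. M)"
        using M sub by (intro integral_norm_bound_integral ig) auto
      then have "\<epsilon> * norm (integral {0..t} (\<lambda>s. g (z s) s)) \<le> \<epsilon> * (M * L)"
        using t mult_left_mono[of t L M] M0 eps01 by (intro mult_left_mono) (auto simp: mult.commute)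
      finally show "norm (z 0 + integral {0..t} (\<lambda>s. X (z s) + \<epsilon> *\<^sub>R g (z s) s) - z t) \<le> \<epsilon> * M * L"
        by (simp add: mult.assoc)
    next
      have "\<epsilon> * M * L * exp (K * L) = \<epsilon> * c" by (simp add: c_def)
      also have "\<dots> \<le> e * c" using eps c0 by (intro mult_right_mono) auto
      also have "\<dots> \<le> r" by (rule e)
      finally show "\<epsilon> * M * L * exp (K * L) \<le> r" .
    next
      fix y assume "y 0 = z 0"
        and "\<And>t. t \<in> {0..L} \<Longrightarrow>
          (y has_vector_derivative X (y t) + \<epsilon> *\<^sub>R g (y t) t) (at t within {0..L})"
        and "\<And>t. t \<in> {0..L} \<Longrightarrow> norm (y t - z t) \<le> \<epsilon> * M * L * exp (K * L)"
      then show ?thesis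
        by (intro exI[of _ y]) (auto simp: c_def mult.assoc)
    qed
  qed
  with c0 e show thesis by (intro that)
qed

lemma first_integral_on_imp_conserved:
  assumes f: "first_integral_on W (\<lambda>(x, t). (Y x t, 1)) f"
    and y: "\<And>t. t \<in> {0..L} \<Longrightarrow> (y has_vector_derivative Y (y t) t) (at t within {0..L})"
    and W: "\<And>t. t \<in> {0..L} \<Longrightarrow> (y t, t) \<in> W" and L: "0 \<le> L"
  shows "f (y L, L) = f (y 0, 0)"
proof -
  have "((\<lambda>t. f (y t, t)) has_derivative (\<lambda>h. 0)) (at t within {0..L})" if t: "t \<in> {0..L}" for t
  proof -
    have diff: "f differentiable (at (y t, t))"
      and zero: "frechet_derivative f (at (y t, t)) (Y (y t) t, 1) = 0"
      using f W[OF t] unfolding first_integral_on_def by auto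
    have D: "(f has_derivative frechet_derivative f (at (y t, t))) (at (y t, t))"
      using diff frechet_derivative_works by blast
    interpret D: bounded_linear "frechet_derivative f (at (y t, t))"
      using D by (rule has_derivative_bounded_linear)
    have curve: "((\<lambda>t. (y t, t)) has_derivative (\<lambda>h. h *\<^sub>R (Y (y t) t, 1))) (at t within {0..L})"
      using has_derivative_Pair[OF y[OF t, unfolded has_vector_derivative_def] has_derivative_ident]
      by simp
    have "((\<lambda>t. f (y t, t)) has_derivative
        (\<lambda>h. frechet_derivative f (at (y t, t)) (h *\<^sub>R (Y (y t) t, 1)))) (at t within {0..L})"
      using has_derivative_compose[OF curve D] .
    then show ?thesis
      by (simp only: D.scaleR zero scaleR_zero_right)
  qed
  then obtain c where "\<forall>t\<in>{0..L}. f (y t, t) = c"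
    using has_derivative_zero_constant[OF convex_real_interval(5)] by blast
  then show ?thesis using L by auto
qed

text \<open>
  The core of the argument, with the circle unrolled to the real line. The functions \<open>f \<epsilon>\<close> are
  conserved by the perturbed system and are compared with \<open>H\<close> to first order in \<open>\<epsilon>\<close> at the two ends
  of \<open>z\<close> only. The limit \<open>stop\<close> has to be taken jointly in \<open>\<epsilon>\<close> and the point, because the perturbed
  solutions end near \<open>z L\<close> and not at it. That both limits are the same number \<open>a\<close> expresses that the
  orbit closes up.
\<close>

lemma first_order_expansion_imp_integral_zero:
  fixes X :: "'a::euclidean_space \<Rightarrow> 'a" and g :: "'a \<Rightarrow> real \<Rightarrow> 'a" and z :: "real \<Rightarrow> 'a"
    and H :: "'a \<Rightarrow> real" and f :: "real \<Rightarrow> 'a \<times> real \<Rightarrow> real"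
  assumes L: "0 \<le> L"
    and lipX: "\<And>C. \<lbrakk>compact C; convex C\<rbrakk> \<Longrightarrow> \<exists>B. B-lipschitz_on C X"
    and lipg: "\<And>C. \<lbrakk>compact C; convex C\<rbrakk> \<Longrightarrow> \<exists>B. B-lipschitz_on C (\<lambda>(x, t). g x t)"
    and z: "\<And>t. t \<in> {0..L} \<Longrightarrow> (z has_vector_derivative X (z t)) (at t within {0..L})"
    and W: "open W" and zW: "\<And>t. t \<in> {0..L} \<Longrightarrow> (z t, t) \<in> W"
    and H: "\<And>x. (H has_derivative (\<lambda>h. dH x \<bullet> h)) (at x)"
    and contdH: "continuous_on UNIV dH" and inv: "\<And>x. dH x \<bullet> X x = 0"
    and \<epsilon>0: "0 < \<epsilon>0"
    and f: "\<And>\<epsilon>. \<epsilon> \<in> {0<..<\<epsilon>0} \<Longrightarrow> first_integral_on W (\<lambda>(x, t). (X x + \<epsilon> *\<^sub>R g x t, 1)) (f \<epsilon>)"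
    and start: "((\<lambda>\<epsilon>. (f \<epsilon> (z 0, 0) - H (z 0)) / \<epsilon>) \<longlongrightarrow> a) (at_right 0)"
    and stop: "((\<lambda>(\<epsilon>, x). (f \<epsilon> (x, L) - H x) / \<epsilon>) \<longlongrightarrow> a) (at_right 0 \<times>\<^sub>F nhds (z L))"
  shows "integral {0..L} (\<lambda>t. dH (z t) \<bullet> g (z t) t) = 0"
proof -
  have contz: "continuous_on {0..L} z"
    by (rule continuous_on_vector_derivative[OF z])
  have comp: "compact ((\<lambda>t. (z t, t)) ` {0..L})"
    by (intro compact_continuous_image continuous_intros contz compact_Icc)
  have sub: "(\<lambda>t. (z t, t)) ` {0..L} \<subseteq> W"
    using zW by blast
  obtain r where r: "0 < r" and rW: "(\<Union>p\<in>(\<lambda>t. (z t, t)) ` {0..L}. cball p r) \<subseteq> W"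
    by (rule compact_subset_open_imp_cball_epsilon_subset[OF comp W sub])
  obtain C e where C: "0 \<le> C" and e: "0 < e" and eC: "e * C \<le> r"
    and sol: "\<And>\<epsilon>. \<epsilon> \<in> {0..e} \<Longrightarrow> \<exists>y. y 0 = z 0 \<and>
      (\<forall>t\<in>{0..L}. (y has_vector_derivative X (y t) + \<epsilon> *\<^sub>R g (y t) t) (at t within {0..L}) \<and>
        norm (y t - z t) \<le> \<epsilon> * C)"
    by (rule perturbed_solutions[OF L lipX lipg z r]; (assumption | rule that; assumption))
  define d where "d = min e (\<epsilon>0 / 2)"
  define s where "s = (\<lambda>n. d * inverse (real (Suc n)))"
  have d: "0 < d" "d \<le> e" "d < \<epsilon>0" using e \<epsilon>0 by (auto simp: d_def)
  have s0: "0 < s n" for n using d by (simp add: s_def)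
  have sd: "s n \<le> d" for n
    using d mult_left_mono[of "inverse (real (Suc n))" 1 d] by (simp add: s_def field_simps)
  have s: "s n \<in> {0..e}" "s n \<in> {0<..<\<epsilon>0}" for n
    using s0[of n] sd[of n] d by auto
  have slim: "s \<longlonglongrightarrow> 0"
    unfolding s_def using tendsto_mult_right_zero[OF LIMSEQ_inverse_real_of_nat] .
  have sright: "filterlim s (at_right 0) sequentially"
    using slim s0 by (intro tendsto_imp_filterlim_at_right) auto
  have "\<forall>n. \<exists>y. y 0 = z 0 \<and>
      (\<forall>t\<in>{0..L}. (y has_vector_derivative X (y t) + s n *\<^sub>R g (y t) t) (at t within {0..L}) \<and>
        norm (y t - z t) \<le> s n * C)"
    using sol s(1) by blast
  then obtain y where y0: "\<And>n. y n 0 = z 0"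
    and y: "\<And>n t. t \<in> {0..L} \<Longrightarrow>
      (y n has_vector_derivative X (y n t) + s n *\<^sub>R g (y n t) t) (at t within {0..L})"
    and yz: "\<And>n t. t \<in> {0..L} \<Longrightarrow> norm (y n t - z t) \<le> s n * C"
    by metis
  have yr: "norm (y n t - z t) \<le> r" if "t \<in> {0..L}" for n t
    using yz[OF that, of n] mult_right_mono[OF _ C, of "s n" e] s(1)[of n] eC by force
  have yW: "(y n t, t) \<in> W" if "t \<in> {0..L}" for n t
  proof -
    have "(y n t, t) \<in> cball (z t, t) r"
      using yr[OF that, of n] by (simp add: dist_Pair_Pair dist_norm norm_minus_commute)
    then show ?thesis using rW that by blast
  qed
  have conserved: "f (s n) (y n L, L) = f (s n) (z 0, 0)" for n
    using first_integral_on_imp_conserved[OF f[OF s(2)[of n]] y yW L] by (simp add: y0)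
  let ?\<phi> = "\<lambda>(x, t). dH x \<bullet> g x t"
  have int: "((\<lambda>t. ?\<phi> (y n t, t)) has_integral (H (y n L) - H (z 0)) / s n) {0..L}" for n
  proof -
    have "((\<lambda>t. s n * ?\<phi> (y n t, t)) has_integral H (y n L) - H (y n 0)) {0..L}"
    proof (rule fundamental_theorem_of_calculus[OF L])
      fix t assume t: "t \<in> {0..L}"
      have "((\<lambda>t. H (y n t)) has_derivative
          (\<lambda>h. dH (y n t) \<bullet> (h *\<^sub>R (X (y n t) + s n *\<^sub>R g (y n t) t)))) (at t within {0..L})"
        using has_derivative_compose[OF y[OF t, unfolded has_vector_derivative_def] H] .
      then show "((\<lambda>t. H (y n t)) has_vector_derivative s n * ?\<phi> (y n t, t)) (at t within {0..L})"
        by (simp add: has_vector_derivative_def inner_add_right inv)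
    qed
    from has_integral_divide[OF this, of "s n"] show ?thesis
      using s0[of n] by (simp add: y0)
  qed
  \<comment> \<open>Energy balance read off from the conserved \<open>f\<close>: the gain divided by \<open>\<epsilon>\<close> tends to \<open>a - a\<close>.\<close>
  have J0: "(\<lambda>n. (H (y n L) - H (z 0)) / s n) \<longlonglongrightarrow> 0"
  proof -
    have "(\<lambda>n. (f (s n) (z 0, 0) - H (z 0)) / s n) \<longlonglongrightarrow> a"
      using filterlim_compose[OF start sright] .
    moreover have "(\<lambda>n. (f (s n) (y n L, L) - H (y n L)) / s n) \<longlonglongrightarrow> a"
    proof -
      have "(\<lambda>n. norm (y n L - z L)) \<longlonglongrightarrow> 0"
        by (rule tendsto_sandwich[OF _ _ tendsto_const tendsto_mult_left_zero[OF slim, of C]])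
          (use yz L in auto)
      then have "(\<lambda>n. y n L) \<longlonglongrightarrow> z L"
        using LIM_zero_iff tendsto_norm_zero_iff by blast
      then have "filterlim (\<lambda>n. (s n, y n L)) (at_right 0 \<times>\<^sub>F nhds (z L)) sequentially"
        using sright by (intro filterlim_Pair)
      from filterlim_compose[OF stop this] show ?thesis by simp
    qed
    ultimately have "(\<lambda>n. (f (s n) (z 0, 0) - H (z 0)) / s n - (f (s n) (y n L, L) - H (y n L)) / s n)
        \<longlonglongrightarrow> a - a"
      by (rule tendsto_diff)
    then show ?thesis
      by (simp add: conserved diff_divide_distrib)
  qed
  \<comment> \<open>Energy balance read off from the equation: the gain divided by \<open>\<epsilon>\<close> tends to the integral along \<open>z\<close>.
    A compact set containing the whole tube around \<open>z\<close> makes the integrands converge uniformly.\<close>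
  obtain R where R: "\<And>t. t \<in> {0..L} \<Longrightarrow> norm (z t) \<le> R"
    using continuous_on_compact_bound[OF compact_Icc contz] by blast
  define D where "D = cball (0::'a) (R + r) \<times> {0..L}"
  have D: "compact D" "convex D"
    by (auto simp: D_def compact_Times convex_Times)
  obtain B where "B-lipschitz_on D (\<lambda>(x, t). g x t)"
    using lipg[OF D] by blast
  then have "continuous_on D (\<lambda>(x, t). g x t)"
    by (rule lipschitz_on_continuous_on)
  then have cont\<phi>: "continuous_on D ?\<phi>"
    unfolding case_prod_unfold
    by (intro continuous_intros continuous_on_compose2[OF contdH]) auto
  have yD: "(y n t, t) \<in> D" if "t \<in> {0..L}" for n t
    using that R[OF that] yr[OF that, of n] norm_triangle_ineq[of "y n t - z t" "z t"]
    by (auto simp: D_def)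
  have "uniform_limit {0..L} (\<lambda>n t. (y n t, t)) (\<lambda>t. (z t, t)) sequentially"
  proof (rule uniform_limitI)
    fix \<eta> :: real assume "0 < \<eta>"
    with tendsto_mult_left_zero[OF slim, of C] have "\<forall>\<^sub>F n in sequentially. s n * C < \<eta>"
      by (rule order_tendstoD)
    then show "\<forall>\<^sub>F n in sequentially. \<forall>t\<in>{0..L}. dist (y n t, t) (z t, t) < \<eta>"
    proof eventually_elim
      case (elim n)
      show ?case
      proof
        fix t assume "t \<in> {0..L}"
        from yz[OF this, of n] elim show "dist (y n t, t) (z t, t) < \<eta>"
          by (simp add: dist_Pair_Pair dist_norm)
      qed
    qed
  qed
  then have "uniform_limit {0..L} (\<lambda>n t. ?\<phi> (y n t, t)) (\<lambda>t. ?\<phi> (z t, t)) sequentially"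
    by (rule uniform_limit_compose_uniformly_continuous_on
        [OF _ compact_uniformly_continuous[OF cont\<phi> D(1)]])
      (use yD D in \<open>auto intro: compact_imp_closed\<close>)
  moreover have "continuous_on {0..L} (\<lambda>t. ?\<phi> (y n t, t))" for n
    by (rule continuous_on_compose2[OF cont\<phi>])
      (use yD continuous_on_vector_derivative[OF y] in \<open>auto intro!: continuous_on_Pair continuous_on_id\<close>)
  ultimately obtain I J where I: "\<And>n. ((\<lambda>t. ?\<phi> (y n t, t)) has_integral I n) {0..L}"
    and J: "((\<lambda>t. ?\<phi> (z t, t)) has_integral J) {0..L}" and IJ: "I \<longlonglongrightarrow> J"
    by (rule uniform_limit_integral) auto
  have "I = (\<lambda>n. (H (y n L) - H (z 0)) / s n)"
    using has_integral_unique[OF I int] by blast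
  with IJ J0 have "J = 0"
    using LIMSEQ_unique by blast
  with J show ?thesis by (simp add: integral_unique)
qed

text \<open>
  Translation is used in the time direction: it moves a closed curve that starts at phase \<open>\<tau>\<close> to one
  that starts at time \<open>0\<close>.
\<close>

lemma first_integral_on_translate:
  assumes "first_integral_on W X f"
  shows "first_integral_on ((\<lambda>p. p + c) -` W) (\<lambda>p. X (p + c)) (\<lambda>p. f (p + c))"
  unfolding first_integral_on_def
proof (intro ballI)
  fix p assume "p \<in> (\<lambda>p. p + c) -` W"
  then have diff: "f differentiable (at (p + c))"
    and zero: "frechet_derivative f (at (p + c)) (X (p + c)) = 0"
    using assms by (auto simp: first_integral_on_def)
  have "((\<lambda>p. p + c) has_derivative (\<lambda>h. h)) (at p)"
    by (auto intro!: derivative_eq_intros)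
  moreover have "(f has_derivative frechet_derivative f (at (p + c))) (at (p + c))"
    using diff frechet_derivative_works by blast
  ultimately have D: "((\<lambda>p. f (p + c)) has_derivative frechet_derivative f (at (p + c))) (at p)"
    using has_derivative_compose by blast
  show "(\<lambda>p. f (p + c)) differentiable (at p) \<and>
      frechet_derivative (\<lambda>p. f (p + c)) (at p) (X (p + c)) = 0"
    using D zero frechet_derivative_at[OF D] by (auto simp: differentiable_def)
qed

section \<open>First order expansion in the parameter\<close>

text \<open>
  By the mean value theorem the difference quotient at \<open>p\<close> is the \<open>\<epsilon>\<close>-derivative at some intermediate
  \<open>\<xi>\<close> between \<open>0\<close> and \<open>\<epsilon>\<close>. Its joint continuity at \<open>(0, p0)\<close> gives a limit that is joint in \<open>\<epsilon>\<close> and \<open>p\<close>.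
\<close>

lemma Ck_dependence_difference_quotient:
  fixes F :: "real \<Rightarrow> 'a::topological_space \<Rightarrow> real"
  assumes F: "Ck_dependence (Suc k) {0..<\<epsilon>0} U F" and \<epsilon>0: "0 < \<epsilon>0" and p0: "p0 \<in> U"
  obtains a where
    "((\<lambda>(\<epsilon>, p). (F \<epsilon> p - F 0 p) / \<epsilon>) \<longlongrightarrow> a) (at_right 0 \<times>\<^sub>F inf (nhds p0) (principal U))"
proof -
  obtain D where D0: "D 0 = F"
    and der: "\<And>\<epsilon> p. \<lbrakk>\<epsilon> \<in> {0..<\<epsilon>0}; p \<in> U\<rbrakk> \<Longrightarrow>
      ((\<lambda>e. D 0 e p) has_real_derivative D (Suc 0) \<epsilon> p) (at \<epsilon> within {0..<\<epsilon>0})"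
    and cont: "continuous_on ({0..<\<epsilon>0} \<times> U) (\<lambda>(\<epsilon>, p). D (Suc 0) \<epsilon> p)"
    using F unfolding Ck_dependence_def by fastforce
  have "((\<lambda>(\<epsilon>, p). (F \<epsilon> p - F 0 p) / \<epsilon>) \<longlongrightarrow> D (Suc 0) 0 p0)
      (at_right 0 \<times>\<^sub>F inf (nhds p0) (principal U))"
  proof (rule topological_tendstoI)
    fix S assume S: "open S" "D (Suc 0) 0 p0 \<in> S"
    have "(0, p0) \<in> {0..<\<epsilon>0} \<times> U" using p0 \<epsilon>0 by auto
    from cont[unfolded continuous_on_topological, THEN bspec, OF this, THEN spec, of S] S
    obtain N where "open N" "(0, p0) \<in> N"
      and N: "\<forall>q\<in>{0..<\<epsilon>0} \<times> U. q \<in> N \<longrightarrow> (\<lambda>(\<epsilon>, p). D (Suc 0) \<epsilon> p) q \<in> S"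
      by auto
    then obtain A B where A: "open A" "0 \<in> A" and B: "open B" "p0 \<in> B" and AB: "A \<times> B \<subseteq> N"
      by (elim open_prod_elim) auto
    obtain d where d: "0 < d" "ball 0 d \<subseteq> A"
      using A open_contains_ball by blast
    have "\<forall>\<^sub>F \<epsilon> in at_right (0::real). \<epsilon> \<in> {0<..<min d \<epsilon>0}"
      using d \<epsilon>0 by (intro eventually_at_right_real) auto
    moreover have "\<forall>\<^sub>F p in inf (nhds p0) (principal U). p \<in> B \<and> p \<in> U"
      unfolding eventually_inf_principal
      using eventually_nhds_in_open[OF B] by eventually_elim auto
    ultimately have "\<forall>\<^sub>F x in at_right 0 \<times>\<^sub>F inf (nhds p0) (principal U).
        fst x \<in> {0<..<min d \<epsilon>0} \<and> snd x \<in> B \<and> snd x \<in> U"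
      by (rule eventually_prodI)
    then show "\<forall>\<^sub>F x in at_right 0 \<times>\<^sub>F inf (nhds p0) (principal U).
        (\<lambda>(\<epsilon>, p). (F \<epsilon> p - F 0 p) / \<epsilon>) x \<in> S"
    proof eventually_elim
      case (elim x)
      obtain \<epsilon> p where x: "x = (\<epsilon>, p)" by (cases x)
      have \<epsilon>: "0 < \<epsilon>" "\<epsilon> < d" "\<epsilon> < \<epsilon>0" and p: "p \<in> B" "p \<in> U"
        using elim by (auto simp: x)
      have "\<exists>\<xi>\<in>{0<..<\<epsilon>}. F \<epsilon> p - F 0 p = D (Suc 0) \<xi> p * (\<epsilon> - 0)"
      proof (rule mvt_simple[OF \<epsilon>(1)])
        fix e assume e: "0 \<le> e" "e \<le> \<epsilon>"
        have "((\<lambda>e. F e p) has_real_derivative D (Suc 0) e p) (at e within {0..\<epsilon>})"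
          by (rule DERIV_subset[OF der[of e p, unfolded D0]]) (use e \<epsilon> p in auto)
        then show "((\<lambda>e. F e p) has_derivative (*) (D (Suc 0) e p)) (at e within {0..\<epsilon>})"
          by (rule has_field_derivative_imp_has_derivative)
      qed
      then obtain \<xi> where \<xi>: "\<xi> \<in> {0<..<\<epsilon>}" and eq: "F \<epsilon> p - F 0 p = D (Suc 0) \<xi> p * \<epsilon>"
        by auto
      have "(\<xi>, p) \<in> N"
        using AB d(2) \<xi> \<epsilon> p(1) by (auto simp: dist_norm subset_iff)
      then have "D (Suc 0) \<xi> p \<in> S"
        using N \<xi> \<epsilon> p(2) by auto
      then show ?case using \<epsilon> by (simp add: x eq)
    qed
  qed
  then show thesis by (rule that)
qed

lemma Ck_dependence_at_0_eq:
  fixes F :: "real \<Rightarrow> 'a::topological_space \<Rightarrow> real"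
  assumes F: "Ck_dependence (Suc k) {0..<\<epsilon>0} U F" and \<epsilon>0: "0 < \<epsilon>0" and p: "p \<in> U"
    and O: "(\<lambda>\<epsilon>. F \<epsilon> p - h) \<in> O[at_right 0](\<lambda>\<epsilon>. \<epsilon>)"
  shows "F 0 p = h"
proof -
  obtain D :: "real" where "((\<lambda>e. F e p) has_real_derivative D) (at 0 within {0..<\<epsilon>0})"
    using F p \<epsilon>0 unfolding Ck_dependence_def by fastforce
  then have "((\<lambda>e. F e p) has_real_derivative D) (at 0 within {0..\<epsilon>0 / 2})"
    by (rule DERIV_subset) (use \<epsilon>0 in auto)
  then have "continuous (at 0 within {0..\<epsilon>0 / 2}) (\<lambda>e. F e p)"
    by (rule DERIV_continuous)
  then have "((\<lambda>\<epsilon>. F \<epsilon> p) \<longlongrightarrow> F 0 p) (at_right 0)"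
    using \<epsilon>0 by (simp add: continuous_within at_within_Icc_at_right)
  then have "((\<lambda>\<epsilon>. F \<epsilon> p - h) \<longlongrightarrow> F 0 p - h) (at_right 0)"
    by (intro tendsto_intros)
  moreover have "((\<lambda>\<epsilon>. F \<epsilon> p - h) \<longlongrightarrow> 0) (at_right 0)"
  proof -
    obtain c where c: "\<forall>\<^sub>F \<epsilon> in at_right 0. norm (F \<epsilon> p - h) \<le> c * norm \<epsilon>"
      using O by (elim landau_o.bigE)
    show ?thesis
    proof (rule tendsto_0_le)
      show "((\<lambda>\<epsilon>::real. \<epsilon>) \<longlongrightarrow> 0) (at_right 0)" by (rule tendsto_ident_at)
      show "\<forall>\<^sub>F \<epsilon> in at_right 0. norm (F \<epsilon> p - h) \<le> norm \<epsilon> * c"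
        using c by (simp add: mult.commute)
    qed
  qed
  ultimately show ?thesis
    using tendsto_unique[OF trivial_limit_at_right_real] by fastforce
qed

section \<open>Planar Hamiltonian vector fields\<close>

lemma has_derivative_grad:
  assumes "H differentiable (at x)"
  shows "(H has_derivative (\<lambda>h. grad H x \<bullet> h)) (at x)"
proof -
  have D: "(H has_derivative frechet_derivative H (at x)) (at x)"
    using assms frechet_derivative_works by blast
  interpret D: bounded_linear "frechet_derivative H (at x)"
    using D by (rule has_derivative_bounded_linear)
  have "frechet_derivative H (at x) h = grad H x \<bullet> h" for h
  proof -
    have "frechet_derivative H (at x) h
        = frechet_derivative H (at x) (\<Sum>i\<in>UNIV. h $ i *\<^sub>R axis i 1)"
      using basis_expansion[of h] by (simp add: scalar_mult_eq_scaleR)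
    also have "\<dots> = grad H x \<bullet> h"
      by (simp add: D.sum D.scaleR inner_vec_def grad_def mult.commute)
    finally show ?thesis .
  qed
  then have "frechet_derivative H (at x) = (\<lambda>h. grad H x \<bullet> h)" by (rule ext)
  then show ?thesis using D by simp
qed

lemma J2_mult: "J2 *v w = vector [w $ 2, - (w $ 1)]"
  by (simp add: J2_def vec_eq_iff forall_2 matrix_vector_mult_def sum_2)

lemma inner_J2_mult: "w \<bullet> (J2 *v w) = 0"
  by (simp add: J2_mult inner_vec_def sum_2)

lemma norm_J2_mult: "norm (J2 *v w) = norm w"
  by (simp add: J2_mult norm_vec_def L2_set_def sum_2 add.commute)

lemma grad_lipschitz_on:
  assumes H: "Ck_on (Suc (Suc k)) UNIV H" and C: "compact C" "convex C"
  shows "\<exists>B. B-lipschitz_on C (grad H)"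
proof -
  have "\<exists>B. B-lipschitz_on C (\<lambda>x. grad H x $ i)" for i
  proof -
    have "Ck_on (Suc k) UNIV (\<lambda>x. frechet_derivative H (at x) (axis i 1))"
      using H by (subst (asm) Ck_on.simps) blast
    from C1_imp_lipschitz_on[OF this C] show ?thesis by (simp add: grad_def)
  qed
  then obtain B where B: "\<And>i. (B i)-lipschitz_on C (\<lambda>x. grad H x $ i)" by metis
  have "(\<Sum>i\<in>UNIV. B i)-lipschitz_on C (grad H)"
  proof (rule lipschitz_onI)
    fix x y assume xy: "x \<in> C" "y \<in> C"
    have "norm (grad H x - grad H y) \<le> (\<Sum>i\<in>UNIV. \<bar>(grad H x - grad H y) $ i\<bar>)"
      by (rule norm_le_l1_cart)
    also have "\<dots> \<le> (\<Sum>i\<in>UNIV. B i * dist x y)"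
      using lipschitz_onD[OF B xy] by (intro sum_mono) (simp add: dist_real_def)
    finally show "dist (grad H x) (grad H y) \<le> (\<Sum>i\<in>UNIV. B i) * dist x y"
      by (simp add: dist_norm sum_distrib_right)
  qed (use lipschitz_on_nonneg[OF B] in \<open>auto intro: sum_nonneg\<close>)
  then show ?thesis ..
qed

lemma continuous_on_grad:
  assumes "Ck_on (Suc (Suc k)) UNIV H"
  shows "continuous_on UNIV (grad H)"
proof -
  have "Ck_on (Suc 0) UNIV H"
    using assms by (rule Ck_on_Suc_0D)
  then show ?thesis
    by (auto simp: grad_def intro!: continuous_on_vec_lambda)
qed

lemma J2_grad_lipschitz_on:
  assumes "Ck_on (Suc (Suc k)) UNIV H" "compact C" "convex C"
  shows "\<exists>B. B-lipschitz_on C (\<lambda>x. J2 *v grad H x)"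
proof -
  obtain B where B: "B-lipschitz_on C (grad H)"
    using grad_lipschitz_on[OF assms] by blast
  have "B-lipschitz_on C (\<lambda>x. J2 *v grad H x)"
  proof (rule lipschitz_onI)
    fix x y assume "x \<in> C" "y \<in> C"
    from lipschitz_onD[OF B this] show "dist (J2 *v grad H x) (J2 *v grad H y) \<le> B * dist x y"
      by (simp add: dist_norm norm_J2_mult flip: matrix_vector_mult_diff_distrib)
  qed (use lipschitz_on_nonneg[OF B] in simp)
  then show ?thesis ..
qed

section \<open>The phase circle\<close>

lemma circ_add: "circ T (s + t) = circ T s * circ T t"
  by (simp add: circ_def cis_mult add_divide_distrib distrib_left)

lemma circ_in_S1 [simp]: "circ T t \<in> S1"
  by (simp add: circ_def S1_def)

lemma continuous_on_circ [continuous_intros]: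
  "continuous_on A f \<Longrightarrow> continuous_on A (\<lambda>x. circ T (f x))"
  unfolding circ_def divide_inverse by (intro continuous_intros)

lemma circ_add_period:
  assumes "T \<noteq> 0"
  shows "circ T (t + real m * T) = circ T t"
proof -
  have "circ T (real m * T) = cis (2 * pi * real m)"
    using assms by (simp add: circ_def mult.assoc del: cis_multiple_2pi)
  also have "\<dots> = 1" by (rule cis_multiple_2pi) simp
  finally show ?thesis by (simp add: circ_add)
qed

lemma open_lift_set:
  assumes "openin (top_of_set (UNIV \<times> S1)) U"
  shows "open (lift_set T U)"
proof -
  obtain V where V: "open V" "U = (UNIV \<times> S1) \<inter> V"
    using assms by (auto simp: openin_open)
  have "lift_set T U = (\<lambda>(x, t). (x, circ T t)) -` V"
    by (auto simp: lift_set_def V)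
  moreover have "continuous_on UNIV (\<lambda>(x::real^2, t). (x, circ T t))"
    by (auto simp: case_prod_unfold intro!: continuous_intros)
  ultimately show ?thesis
    using V(1) by (simp add: continuous_on_open_vimage)
qed

text \<open>
  The phases \<open>w\<close> excluded from the set are the projection of a closed condition along the compact
  parameter interval, hence form a compact set.
\<close>

lemma openin_S1_all_in:
  assumes U: "openin (top_of_set (UNIV \<times> S1)) U" and q: "continuous_on UNIV q"
  shows "openin (top_of_set S1) {w \<in> S1. \<forall>s\<in>{a..b}. (q s, w * circ T s) \<in> U}"
proof -
  obtain V where V: "open V" "U = (UNIV \<times> S1) \<inter> V"
    using U by (auto simp: openin_open)
  define N where "N = ({a..b} \<times> S1) \<inter> (\<lambda>(s, w). (q s, w * circ T s)) -` (- V)"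
  have "continuous_on UNIV (\<lambda>(s, w). (q s, w * circ T s))"
    unfolding case_prod_unfold
    by (intro continuous_intros continuous_on_compose2[OF q]) auto
  then have "closed ((\<lambda>(s, w). (q s, w * circ T s)) -` (- V))"
    using V(1) by (simp add: continuous_on_closed_vimage closed_Compl)
  then have "compact N"
    unfolding N_def by (intro compact_Int_closed compact_Times) (auto simp: S1_def)
  then have "compact (snd ` N)"
    by (intro compact_continuous_image continuous_intros)
  moreover have "{w \<in> S1. \<forall>s\<in>{a..b}. (q s, w * circ T s) \<in> U} = S1 \<inter> - (snd ` N)"
  proof -
    have "w * circ T s \<in> S1" if "w \<in> S1" for w s
      using that circ_in_S1[of T s] by (simp add: S1_def norm_mult)
    moreover have "w \<in> snd ` N \<longleftrightarrow> w \<in> S1 \<and> (\<exists>s\<in>{a..b}. (q s, w * circ T s) \<notin> V)" for w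
      by (force simp: N_def)
    ultimately show ?thesis
      by (intro set_eqI) (simp add: V(2); blast)
  qed
  ultimately show ?thesis
    by (simp add: openin_open_Int compact_imp_closed open_Compl)
qed

section \<open>The subharmonic Melnikov function\<close>

text \<open>
  A single phase \<open>\<tau>\<close>. Time is shifted by \<open>\<tau>\<close>, so that the curve \<open>t \<mapsto> (z(t), t + \<tau>)\<close> starts at time \<open>0\<close>.
  Its two end points are different over the real line but agree over the circle, which is where
  \<open>F\<close> lives; hence the first order terms of \<open>F\<close> at both ends have the same limit.
\<close>

lemma Melnikov_zero:
  fixes H :: "real^2 \<Rightarrow> real" and g :: "real^2 \<Rightarrow> real \<Rightarrow> real^2"
    and F :: "real \<Rightarrow> (real^2) \<times> complex \<Rightarrow> real"
  assumes T: "T > 0"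
    and H: "Ck_on (Suc (Suc k)) UNIV H"
    and g: "Ck_on (Suc n) UNIV (\<lambda>(x, t). g x t)"
    and z: "\<And>t. (z has_vector_derivative J2 *v grad H (z t)) (at t)"
    and closed: "z (real m * T) = z 0"
    and U: "openin (top_of_set (UNIV \<times> S1)) U"
    and zU: "\<And>t. t \<in> {0..real m * T} \<Longrightarrow> (z t, circ T (t + \<tau>)) \<in> U"
    and \<epsilon>0: "0 < \<epsilon>0"
    and fi: "\<And>\<epsilon>. \<epsilon> \<in> {0<..<\<epsilon>0} \<Longrightarrow>
      first_integral_on (lift_set T U) (perturbed_field H g \<epsilon>) (lift_fun T (F \<epsilon>))"
    and F: "Ck_dependence (Suc j) {0..<\<epsilon>0} U F"
    and O: "\<And>p. p \<in> U \<Longrightarrow> (\<lambda>\<epsilon>. F \<epsilon> p - H (fst p)) \<in> O[at_right 0](\<lambda>\<epsilon>. \<epsilon>)"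
  shows "Melnikov H g T m z \<tau> = 0"
proof -
  define L where "L = real m * T"
  define c where "c = circ T \<tau>"
  have cL: "circ T (L + \<tau>) = c"
    using circ_add_period[of T \<tau> m] T by (simp add: L_def c_def add.commute)
  have L: "0 \<le> L" using T by (simp add: L_def)
  have zL: "z L = z 0" using closed by (simp add: L_def)
  have p0: "(z 0, c) \<in> U"
    using zU[of 0] L by (simp add: L_def c_def)
  define W where "W = (\<lambda>p. p + (0, \<tau>)) -` lift_set T U"
  define f where "f = (\<lambda>\<epsilon> p. lift_fun T (F \<epsilon>) (p + (0, \<tau>)))"
  have f_eq: "f \<epsilon> (x, t) = F \<epsilon> (x, circ T (t + \<tau>))" for \<epsilon> x t
    by (simp add: f_def lift_fun_def)
  obtain a where "((\<lambda>(\<epsilon>, p). (F \<epsilon> p - F 0 p) / \<epsilon>) \<longlongrightarrow> a)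
      (at_right 0 \<times>\<^sub>F inf (nhds (z 0, c)) (principal U))"
    using Ck_dependence_difference_quotient[OF F \<epsilon>0 p0] .
  have "integral {0..L} (\<lambda>t. grad H (z t) \<bullet> g (z t) (t + \<tau>)) = 0"
  proof (rule first_order_expansion_imp_integral_zero[where X = "\<lambda>x. J2 *v grad H x" and H = H
        and f = f and W = W and a = a])
    have F0: "F 0 p = H (fst p)" if "p \<in> U" for p
      using Ck_dependence_at_0_eq[OF F \<epsilon>0 that O[OF that]] .
    \<comment> \<open>Near \<open>(z 0, c)\<close> only the first component varies along the two families of points below.\<close>
    have quot: "((\<lambda>i. (F (e i) (x i, c) - H (x i)) / e i) \<longlongrightarrow> a) G"
      if e: "filterlim e (at_right 0) G" and x: "filterlim x (nhds (z 0)) G" for e x and G :: "'i filter"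
    proof -
      have "open ((\<lambda>x. (x, \<tau>)) -` lift_set T U)"
        by (intro open_vimage open_lift_set U continuous_intros)
      then have "\<forall>\<^sub>F x in nhds (z 0). (x, c) \<in> U"
        using p0 eventually_nhds_in_open[of "(\<lambda>x. (x, \<tau>)) -` lift_set T U" "z 0"]
        by (simp add: lift_set_def c_def)
      then have inU: "\<forall>\<^sub>F i in G. (x i, c) \<in> U"
        using x by (rule eventually_compose_filterlim)
      have "filterlim (\<lambda>i. (x i, c)) (nhds (z 0, c)) G"
        using x by (intro tendsto_Pair tendsto_const)
      then have "filterlim (\<lambda>i. (x i, c)) (inf (nhds (z 0, c)) (principal U)) G"
        using inU by (simp add: filterlim_inf filterlim_principal)
      from filterlim_compose[OF \<open>((\<lambda>(\<epsilon>, p). (F \<epsilon> p - F 0 p) / \<epsilon>) \<longlongrightarrow> a) _\<close> filterlim_Pair[OF e this]]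
      have "((\<lambda>i. (F (e i) (x i, c) - F 0 (x i, c)) / e i) \<longlongrightarrow> a) G"
        by simp
      then show ?thesis
        by (rule Lim_transform_eventually) (use inU F0 in \<open>auto elim: eventually_mono\<close>)
    qed
    show "((\<lambda>\<epsilon>. (f \<epsilon> (z 0, 0) - H (z 0)) / \<epsilon>) \<longlongrightarrow> a) (at_right 0)"
      using quot[of "\<lambda>\<epsilon>. \<epsilon>" _ "\<lambda>_. z 0"] by (simp add: f_eq c_def filterlim_ident)
    show "((\<lambda>(\<epsilon>, x). (f \<epsilon> (x, L) - H x) / \<epsilon>) \<longlongrightarrow> a) (at_right 0 \<times>\<^sub>F nhds (z L))"
      using quot[OF filterlim_fst filterlim_snd] by (simp add: f_eq cL zL case_prod_unfold)
    show "\<exists>B. B-lipschitz_on C (\<lambda>x. J2 *v grad H x)" if "compact C" "convex C" for C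
      using J2_grad_lipschitz_on[OF H that] .
    show "\<exists>B. B-lipschitz_on C (\<lambda>(x, t). g x (t + \<tau>))" if C: "compact C" "convex C"
      for C :: "((real^2) \<times> real) set"
    proof -
      let ?C = "(\<lambda>p. (0, \<tau>) + p) ` C"
      obtain B where B: "B-lipschitz_on ?C (\<lambda>(x, t). g x t)"
        using C1_imp_lipschitz_on[OF g, of ?C] C compact_translation convex_translation by blast
      have "1-lipschitz_on C (\<lambda>p. (0, \<tau>) + p)"
        by (rule lipschitz_onI) auto
      from lipschitz_on_compose2[OF this B] show ?thesis
        by (auto simp: case_prod_unfold add.commute)
    qed
    show "first_integral_on W (\<lambda>(x, t). (J2 *v grad H x + \<epsilon> *\<^sub>R g x (t + \<tau>), 1)) (f \<epsilon>)"
      if "\<epsilon> \<in> {0<..<\<epsilon>0}" for \<epsilon>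
      using first_integral_on_translate[OF fi[OF that], of "(0, \<tau>)"]
      by (simp add: W_def f_def perturbed_field_def case_prod_unfold)
    show "open W"
      unfolding W_def by (intro open_vimage open_lift_set U continuous_intros)
    show "(z t, t) \<in> W" if "t \<in> {0..L}" for t
      using zU that by (simp add: W_def lift_set_def L_def)
    show "(H has_derivative (\<bullet>) (grad H x)) (at x)" for x
      using has_derivative_grad[of H x] H by auto
    show "continuous_on UNIV (grad H)"
      using continuous_on_grad[OF H] .
    show "(z has_vector_derivative J2 *v grad H (z t)) (at t within {0..L})" for t
      using z by (rule has_vector_derivative_at_within)
  qed (use L \<epsilon>0 inner_J2_mult in auto)
  then show ?thesis by (simp add: Melnikov_def L_def)
qed

theorem theorem4p3:
  fixes H :: "real^2 \<Rightarrow> real"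
    and g :: "real^2 \<Rightarrow> real \<Rightarrow> real^2"
    and T :: real
    and q :: "real \<Rightarrow> real \<Rightarrow> real^2"
    and per :: "real \<Rightarrow> real"
    and \<alpha>1 \<alpha>2 \<alpha> :: real
    and l m :: nat
    and \<tau>0 \<epsilon>0 :: real
    and U :: "((real^2) \<times> complex) set"
    and F :: "real \<Rightarrow> (real^2) \<times> complex \<Rightarrow> real"
  assumes "T > 0"
    and "Ck_on 3 UNIV H"
    and "Ck_on 2 UNIV (\<lambda>(x, t). g x t)"
    and "\<And>x t. g x (t + T) = g x t"
    and "\<alpha>1 < \<alpha>2"
    and "\<And>\<beta>. \<beta> \<in> {\<alpha>1<..<\<alpha>2} \<Longrightarrow> periodic_orbit (\<lambda>x. J2 *v grad H x) (per \<beta>) (q \<beta>)"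
    and "\<alpha> \<in> {\<alpha>1<..<\<alpha>2}"
    and "l > 0" and "m > 0" and "coprime l m"
    and "real l * per \<alpha> = real m * T"
    and "openin (top_of_set (UNIV \<times> S1)) U"
    and "resonant_orbit T m (q \<alpha>) \<tau>0 \<subseteq> U"
    and "\<epsilon>0 > 0"
    and "\<And>\<epsilon>. \<epsilon> \<in> {0..<\<epsilon>0} \<Longrightarrow> Ck_on 3 (lift_set T U) (lift_fun T (F \<epsilon>))"
    and "\<And>\<epsilon>. \<epsilon> \<in> {0..<\<epsilon>0} \<Longrightarrow>
           first_integral_on (lift_set T U) (perturbed_field H g \<epsilon>) (lift_fun T (F \<epsilon>))"
    and "Ck_dependence 2 {0..<\<epsilon>0} U F"
    and "\<And>p. p \<in> U \<Longrightarrow> (\<lambda>\<epsilon>. F \<epsilon> p - H (fst p)) \<in> O[at_right 0](\<lambda>\<epsilon>. \<epsilon>)"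
  shows "\<exists>P. openin (top_of_set S1) P \<and> connected P \<and> circ T \<tau>0 \<in> P \<and>
           (\<forall>\<tau>. circ T \<tau> \<in> P \<longrightarrow> Melnikov H g T m (q \<alpha>) \<tau> = 0)"
proof -
  let ?L = "real m * T"
  have orbit: "\<And>t. (q \<alpha> has_vector_derivative J2 *v grad H (q \<alpha> t)) (at t)"
    and per: "\<And>t. q \<alpha> (t + per \<alpha>) = q \<alpha> t"
    using assms(6)[OF assms(7)] by (auto simp: periodic_orbit_def)
  have L: "0 < ?L" using assms(1,9) by simp
  interpret q: periodic_fun_simple "q \<alpha>" "per \<alpha>"
    by standard (rule per)
  have qL: "q \<alpha> (t + ?L) = q \<alpha> t" for t
    using q.plus_of_nat[of t l] assms(11) by simp
  interpret qL: periodic_fun_simple "q \<alpha>" ?L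
    by standard (rule qL)
  interpret circL: periodic_fun_simple "circ T" ?L
    by standard (use assms(1) in \<open>simp add: circ_add_period\<close>)
  have contq: "continuous_on UNIV (q \<alpha>)"
    using orbit by (intro continuous_at_imp_continuous_on)
      (auto intro: has_vector_derivative_continuous)
  define V where "V = {w \<in> S1. \<forall>s\<in>{0..?L}. (q \<alpha> s, w * circ T s) \<in> U}"
  have openV: "openin (top_of_set S1) V"
    unfolding V_def by (rule openin_S1_all_in[OF assms(12) contq])
  \<comment> \<open>The resonant orbit is given for times in \<open>[0, m T)\<close>; reduce \<open>s + \<tau>0\<close> modulo \<open>m T\<close>, a common
    period of \<open>q \<alpha>\<close> and \<open>circ T\<close>.\<close>
  have "(q \<alpha> s, circ T (s + \<tau>0)) \<in> U" for s
  proof -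
    define i where "i = \<lfloor>(s + \<tau>0) / ?L\<rfloor>"
    define t where "t = s + \<tau>0 - of_int i * ?L"
    have "of_int i \<le> (s + \<tau>0) / ?L" "(s + \<tau>0) / ?L < of_int i + 1"
      unfolding i_def by linarith+
    then have "t \<in> {0..<?L}"
      using L by (simp add: t_def field_simps)
    then have "(q \<alpha> (t - \<tau>0), circ T t) \<in> U"
      using assms(13) by (auto simp: resonant_orbit_def)
    moreover have "q \<alpha> (t - \<tau>0) = q \<alpha> s"
      using qL.minus_of_int[of s i] by (simp add: t_def algebra_simps)
    moreover have "circ T t = circ T (s + \<tau>0)"
      using circL.minus_of_int[of "s + \<tau>0" i] by (simp add: t_def)
    ultimately show ?thesis by simp
  qed
  then have "circ T \<tau>0 \<in> V"
    by (simp add: V_def flip: circ_add add: add.commute)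
  then obtain P where P: "openin (top_of_set S1) P" "connected P" "circ T \<tau>0 \<in> P" "P \<subseteq> V"
    using openV locally_connected_sphere[of "0::complex" 1] unfolding locally_connected S1_def
    by meson
  have "Melnikov H g T m (q \<alpha>) \<tau> = 0" if "circ T \<tau> \<in> P" for \<tau>
  proof (rule Melnikov_zero[OF assms(1) _ _ orbit _ assms(12) _ assms(14) _ _ assms(18)])
    show "Ck_on (Suc (Suc 1)) UNIV H" "Ck_on (Suc 1) UNIV (\<lambda>(x, t). g x t)"
      "Ck_dependence (Suc 1) {0..<\<epsilon>0} U F"
      using assms(2,3,17) by (simp_all add: numeral_3_eq_3 numeral_2_eq_2)
    show "q \<alpha> ?L = q \<alpha> 0" using qL[of 0] by simp
    show "(q \<alpha> t, circ T (t + \<tau>)) \<in> U" if "t \<in> {0..?L}" for t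
    proof -
      have "circ T \<tau> \<in> V" using \<open>circ T \<tau> \<in> P\<close> P(4) by blast
      with that show ?thesis by (auto simp: V_def circ_add mult.commute[of "circ T t"])
    qed
    show "first_integral_on (lift_set T U) (perturbed_field H g \<epsilon>) (lift_fun T (F \<epsilon>))"
      if "\<epsilon> \<in> {0<..<\<epsilon>0}" for \<epsilon>
      using assms(16) that by simp
  qed
  with P show ?thesis by blast
qed

end
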